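(* Let $X$ be a path connected topological space and let $x\in X$. (1) If $\pi_1^{qs}(X,x)=1$, then $X$ is homotopically path Hausdorff. (2) If $X$ is homotopically path Hausdorff relative to a subgroup $H\leq\pi_1(X,x)$, then $\pi_H^{qs}(X,x)=H$. Moreover, if $X$ is homotopically path Hausdorff, then $\pi_H^{qs}(X,x)=H$ for every $H\leq\pi_1(X,x)$.
   Context: All spaces are assumed path connected. $I=[0,1]$, $\dot I=\{0,1\}$; $\simeq$ rel $\dot I$ denotes homotopy of paths relative to endpoints, and $[f]$ is the homotopy class of a path $f$ rel $\dot I$. $*$ is concatenation of paths, $g^{-1}$ is the reverse path, $c_x$ is the constant path at $x$, and $P(X,x)$ is the set of all paths in $X$ with initial point $x$. Closeness: let $f,g:I\to X$ be paths with $f(0)=g(0)$ and $f(1)=g(1)$. We say $f$ is homotopically close to $g$ rel $\dot I$ (written $f\xrightarrow{close} g$ rel $\dot I$) if for every partition $0=t_0<t_1<\cdots<t_n=1$ and every sequence of open sets $U_1,\ldots,U_n$ of $X$ with $g([t_{i-1},t_i])\subset U_i$ for all $i$, there is a path $\gamma$ with $\gamma([t_{i-1},t_i])\subset U_i$ for $1\le i\le n$, $\gamma(t_i)=g(t_i)$ for $0\le i\le n$, and $\gamma\simeq f$ rel $\dot I$. For a subset $H\subseteq\pi_1(X,x)$, $\pi_H^{qs}(X,x)=\{[f]\in\pi_1(X,x) : f\xrightarrow{close} h \text{ rel } \dot I \text{ for some loop } h \text{ at } x \text{ with } [h]\in H\}$. For $H=\{[c_x]\}$ the trivial subgroup, write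 $\pi_1^{qs}(X,x)$. $X$ is homotopically path Hausdorff relative to a subset $H\subseteq\pi_1(X,x)$ if for every pair of paths $\alpha,\beta\in P(X,x)$ with $\alpha(1)=\beta(1)$ and $[\alpha*\beta^{-1}]\notin H$, there are a partition $0=t_0<t_1<\cdots<t_n=1$ and open sets $U_1,\ldots,U_n$ with $\alpha([t_{i-1},t_i])\subset U_i$ such that for every path $\gamma:[0,1]\to X$ satisfying $\gamma([t_{i-1},t_i])\subset U_i$ for $1\le i\le n$ and $\gamma(t_i)=\alpha(t_i)$ for $0\le i\le n$, one has $[\gamma*\beta^{-1}]\notin H$. $X$ is homotopically path Hausdorff if it is homotopically path Hausdorff relative to the trivial subgroup of $\pi_1(X,x)$. *)

theory Defs
  imports "HOL-Analysis.Analysis" "HOL-Algebra.Group"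
begin

text \<open>
  A topological space is a set \<open>X\<close> in a type of class \<open>topological_space\<close>, carrying the subspace
  topology \<open>top_of_set X\<close>; the whole type is the case \<open>X = UNIV\<close>. No separation is assumed.
\<close>

section \<open>Homotopy classes of paths and the fundamental group\<close>

definition path_in :: "'a::topological_space set \<Rightarrow> (real \<Rightarrow> 'a) \<Rightarrow> bool" where
  "path_in X f \<longleftrightarrow> path f \<and> path_image f \<subseteq> X"

definition paths_from :: "'a::topological_space set \<Rightarrow> 'a \<Rightarrow> (real \<Rightarrow> 'a) set" where
  "paths_from X x = {f. path_in X f \<and> pathstart f = x}"

definition loops_at :: "'a::topological_space set \<Rightarrow> 'a \<Rightarrow> (real \<Rightarrow> 'a) set" where
  "loops_at X x = {f. path_in X f \<and> pathstart f = x \<and> pathfinish f = x}"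

definition path_class :: "'a::topological_space set \<Rightarrow> (real \<Rightarrow> 'a) \<Rightarrow> (real \<Rightarrow> 'a) set" where
  "path_class X f = {g. homotopic_paths X f g}"

definition fundamental_group ::
    "'a::topological_space set \<Rightarrow> 'a \<Rightarrow> (real \<Rightarrow> 'a) set monoid" where
  "fundamental_group X x =
     \<lparr>carrier = path_class X ` loops_at X x,
      monoid.mult = (\<lambda>A B. \<Union>f\<in>A. \<Union>g\<in>B. path_class X (f +++ g)),
      one = path_class X (\<lambda>_. x)\<rparr>"

lemma path_class_eq_iff:
  assumes "path_in X f"
  shows "path_class X f = path_class X g \<longleftrightarrow> homotopic_paths X f g"
proof
  assume "path_class X f = path_class X g"
  moreover have "f \<in> path_class X f"
    using assms by (simp add: path_class_def path_in_def)
  ultimately show "homotopic_paths X f g"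
    by (simp add: path_class_def homotopic_paths_sym_eq)
next
  assume "homotopic_paths X f g"
  then show "path_class X f = path_class X g"
    unfolding path_class_def by (blast intro: homotopic_paths_trans homotopic_paths_sym)
qed

lemma const_in_loops_at: "x \<in> X \<Longrightarrow> (\<lambda>_. x) \<in> loops_at X x"
  by (auto simp: loops_at_def path_in_def path_def path_image_def pathstart_def pathfinish_def)

lemma join_in_loops_at: "f \<in> loops_at X x \<Longrightarrow> g \<in> loops_at X x \<Longrightarrow> f +++ g \<in> loops_at X x"
  by (simp add: loops_at_def path_in_def path_join_imp subset_path_image_join)

lemma reversepath_in_loops_at: "f \<in> loops_at X x \<Longrightarrow> reversepath f \<in> loops_at X x"
  by (auto simp: loops_at_def path_in_def)

lemma fundamental_group_mult_class:
  assumes "f \<in> loops_at X x" "g \<in> loops_at X x"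
  shows "path_class X f \<otimes>\<^bsub>fundamental_group X x\<^esub> path_class X g = path_class X (f +++ g)"
proof -
  have "path_class X (f' +++ g') = path_class X (f +++ g)"
    if "homotopic_paths X f f'" "homotopic_paths X g g'" for f' g'
  proof -
    have "homotopic_paths X (f +++ g) (f' +++ g')"
      using assms that by (intro homotopic_paths_join) (auto simp: loops_at_def)
    moreover have "path_in X (f +++ g)"
      using join_in_loops_at[OF assms] by (simp add: loops_at_def)
    ultimately show ?thesis
      by (simp add: path_class_eq_iff[THEN iffD2])
  qed
  then have "(\<Union>f'\<in>path_class X f. \<Union>g'\<in>path_class X g. path_class X (f' +++ g')) =
      (\<Union>f'\<in>path_class X f. \<Union>g'\<in>path_class X g. path_class X (f +++ g))"
    by (intro SUP_cong) (auto simp: path_class_def)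
  moreover have "f \<in> path_class X f" "g \<in> path_class X g"
    using assms by (auto simp: path_class_def loops_at_def path_in_def)
  ultimately show ?thesis
    unfolding fundamental_group_def by auto
qed

text \<open>
  The library proves the unit and inverse laws up to homotopy only in real normed vector spaces,
  since it states them with \<open>linepath\<close>. In general they are images of the laws in \<open>[0,1]\<close>.
\<close>

lemma homotopic_paths_image_unit_interval:
  assumes "path_in X f" "homotopic_paths {0..1} p q"
    and "\<And>s. s \<in> {0..1} \<Longrightarrow> f (p s) = p' s" "\<And>s. s \<in> {0..1} \<Longrightarrow> f (q s) = q' s"
  shows "homotopic_paths X p' q'"
proof -
  have *: "homotopic_paths X (f \<circ> p) (f \<circ> q)"
    using assms by (intro homotopic_paths_continuous_image[of "{0..1}"])
      (auto simp: path_in_def path_def path_image_def)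
  have "homotopic_paths X (f \<circ> p) p'"
    using * assms(3) by (intro homotopic_paths_eq)
      (auto dest: homotopic_paths_imp_path homotopic_paths_imp_subset)
  moreover have "homotopic_paths X (f \<circ> q) q'"
    using * assms(4) by (intro homotopic_paths_eq)
      (auto dest: homotopic_paths_imp_path homotopic_paths_imp_subset)
  ultimately show ?thesis
    using * by (meson homotopic_paths_trans homotopic_paths_sym)
qed

lemma homotopic_paths_lid_const:
  assumes "path_in X f"
  shows "homotopic_paths X ((\<lambda>_. pathstart f) +++ f) f"
proof (rule homotopic_paths_image_unit_interval[OF assms])
  show "homotopic_paths {0..1} (linepath 0 0 +++ linepath 0 (1::real)) (linepath 0 1)"
    by (rule homotopic_paths_lid') (simp_all add: closed_segment_eq_real_ivl)
qed (auto simp: joinpaths_def linepath_def pathstart_def)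

lemma homotopic_paths_linv_const:
  assumes "path_in X f"
  shows "homotopic_paths X (reversepath f +++ f) (\<lambda>_. pathfinish f)"
proof (rule homotopic_paths_image_unit_interval[OF assms])
  show "homotopic_paths {0..1} (reversepath (linepath 0 (1::real)) +++ linepath 0 1) (linepath 1 1)"
    using homotopic_paths_linv[of "linepath 0 (1::real)" "{0..1}"]
    by (simp add: closed_segment_eq_real_ivl)
qed (auto simp: joinpaths_def reversepath_def linepath_def pathfinish_def)

lemma group_fundamental_group:
  assumes "x \<in> X"
  shows "group (fundamental_group X x)"
proof (rule groupI)
  let ?G = "fundamental_group X x"
  have carr: "carrier ?G = path_class X ` loops_at X x"
    and one: "\<one>\<^bsub>?G\<^esub> = path_class X (\<lambda>_. x)"
    by (simp_all add: fundamental_group_def)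
  note mult = fundamental_group_mult_class
  note c = const_in_loops_at[OF assms]
  have eqI: "path_class X f = path_class X g" if "homotopic_paths X f g" for f g
  proof -
    have "path_in X f"
      using homotopic_paths_imp_path[OF that] homotopic_paths_imp_subset[OF that]
      by (simp add: path_in_def)
    then show ?thesis
      using that by (simp add: path_class_eq_iff)
  qed
  show "A \<otimes>\<^bsub>?G\<^esub> B \<in> carrier ?G" if "A \<in> carrier ?G" "B \<in> carrier ?G" for A B
    using that by (auto simp: carr mult join_in_loops_at)
  show "\<one>\<^bsub>?G\<^esub> \<in> carrier ?G"
    using c by (simp add: carr one)
  show "A \<otimes>\<^bsub>?G\<^esub> B \<otimes>\<^bsub>?G\<^esub> C = A \<otimes>\<^bsub>?G\<^esub> (B \<otimes>\<^bsub>?G\<^esub> C)"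
    if ABC: "A \<in> carrier ?G" "B \<in> carrier ?G" "C \<in> carrier ?G" for A B C
  proof -
    obtain f g h where *: "f \<in> loops_at X x" "g \<in> loops_at X x" "h \<in> loops_at X x"
      "A = path_class X f" "B = path_class X g" "C = path_class X h"
      using ABC by (auto simp: carr)
    have "homotopic_paths X (f +++ (g +++ h)) ((f +++ g) +++ h)"
      using * by (intro homotopic_paths_assoc) (auto simp: loops_at_def path_in_def)
    from eqI[OF this] show ?thesis
      using * by (simp add: mult join_in_loops_at)
  qed
  show "\<one>\<^bsub>?G\<^esub> \<otimes>\<^bsub>?G\<^esub> A = A" if A: "A \<in> carrier ?G" for A
  proof -
    obtain f where f: "f \<in> loops_at X x" "A = path_class X f"
      using A by (auto simp: carr)
    then have "homotopic_paths X ((\<lambda>_. x) +++ f) f"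
      using homotopic_paths_lid_const[of X f] by (simp add: loops_at_def)
    then have "path_class X ((\<lambda>_. x) +++ f) = path_class X f"
      by (rule eqI)
    then show ?thesis
      using f by (simp add: one mult[OF c])
  qed
  show "\<exists>B\<in>carrier ?G. B \<otimes>\<^bsub>?G\<^esub> A = \<one>\<^bsub>?G\<^esub>" if A: "A \<in> carrier ?G" for A
  proof -
    obtain f where f: "f \<in> loops_at X x" "A = path_class X f"
      using A by (auto simp: carr)
    then have "homotopic_paths X (reversepath f +++ f) (\<lambda>_. x)"
      using homotopic_paths_linv_const[of X f] by (simp add: loops_at_def)
    then have "path_class X (reversepath f +++ f) = path_class X (\<lambda>_. x)"
      by (rule eqI)
    then have "path_class X (reversepath f) \<otimes>\<^bsub>?G\<^esub> A = \<one>\<^bsub>?G\<^esub>"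
      using f by (simp add: one mult reversepath_in_loops_at)
    then show ?thesis
      using f by (auto simp: carr reversepath_in_loops_at)
  qed
qed

section \<open>Closeness and the homotopically path Hausdorff property\<close>

definition unit_partition :: "nat \<Rightarrow> (nat \<Rightarrow> real) \<Rightarrow> bool" where
  "unit_partition n t \<longleftrightarrow> t 0 = 0 \<and> t n = 1 \<and> (\<forall>i<n. t i < t (Suc i))"

definition covers_path ::
    "'a::topological_space set \<Rightarrow> nat \<Rightarrow> (nat \<Rightarrow> real) \<Rightarrow> (nat \<Rightarrow> 'a set) \<Rightarrow> (real \<Rightarrow> 'a) \<Rightarrow> bool" where
  "covers_path X n t U g \<longleftrightarrow>
     (\<forall>i\<in>{1..n}. openin (top_of_set X) (U i) \<and> g ` {t (i - 1)..t i} \<subseteq> U i)"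

definition follows_path ::
    "'a::topological_space set \<Rightarrow> nat \<Rightarrow> (nat \<Rightarrow> real) \<Rightarrow> (nat \<Rightarrow> 'a set) \<Rightarrow>
       (real \<Rightarrow> 'a) \<Rightarrow> (real \<Rightarrow> 'a) \<Rightarrow> bool" where
  "follows_path X n t U g \<gamma> \<longleftrightarrow>
     path_in X \<gamma> \<and> (\<forall>i\<in>{1..n}. \<gamma> ` {t (i - 1)..t i} \<subseteq> U i) \<and> (\<forall>i\<in>{0..n}. \<gamma> (t i) = g (t i))"

definition homotopically_close ::
    "'a::topological_space set \<Rightarrow> (real \<Rightarrow> 'a) \<Rightarrow> (real \<Rightarrow> 'a) \<Rightarrow> bool" where
  "homotopically_close X f g \<longleftrightarrow>
     path_in X f \<and> path_in X g \<and> pathstart f = pathstart g \<and> pathfinish f = pathfinish g \<and>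
     (\<forall>n t U. unit_partition n t \<longrightarrow> covers_path X n t U g \<longrightarrow>
        (\<exists>\<gamma>. follows_path X n t U g \<gamma> \<and> homotopic_paths X \<gamma> f))"

definition pi1_qs ::
    "'a::topological_space set \<Rightarrow> 'a \<Rightarrow> (real \<Rightarrow> 'a) set set \<Rightarrow> (real \<Rightarrow> 'a) set set" where
  "pi1_qs X x H =
     {path_class X f | f. f \<in> loops_at X x \<and>
        (\<exists>h\<in>loops_at X x. path_class X h \<in> H \<and> homotopically_close X f h)}"

definition homotopically_path_Hausdorff_rel ::
    "'a::topological_space set \<Rightarrow> 'a \<Rightarrow> (real \<Rightarrow> 'a) set set \<Rightarrow> bool" where
  "homotopically_path_Hausdorff_rel X x H \<longleftrightarrow>
     (\<forall>\<alpha>\<in>paths_from X x. \<forall>\<beta>\<in>paths_from X x.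
        pathfinish \<alpha> = pathfinish \<beta> \<longrightarrow> path_class X (\<alpha> +++ reversepath \<beta>) \<notin> H \<longrightarrow>
        (\<exists>n t U. unit_partition n t \<and> covers_path X n t U \<alpha> \<and>
           (\<forall>\<gamma>. follows_path X n t U \<alpha> \<gamma> \<longrightarrow> path_class X (\<gamma> +++ reversepath \<beta>) \<notin> H)))"

text \<open>
  The paths under consideration start at the base point \<open>x\<close>, so the base point remains a parameter
  of the absolute notion.
\<close>

definition homotopically_path_Hausdorff :: "'a::topological_space set \<Rightarrow> 'a \<Rightarrow> bool" where
  "homotopically_path_Hausdorff X x \<longleftrightarrow>
     homotopically_path_Hausdorff_rel X x {\<one>\<^bsub>fundamental_group X x\<^esub>}"

end

theory Submission
  imports Defs
begin

text \<open>
  Both notions compare the same data. For paths \<open>\<alpha>\<close> and \<open>\<beta>\<close> with common endpoints,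
  \<open>[\<alpha> * \<beta>\<^sup>-\<^sup>1] = 1\<close> means \<open>\<alpha> \<simeq> \<beta>\<close> (lemma \<open>path_class_join_reversepath_eq_one_iff\<close>). Hence
  the Hausdorff property relative to the trivial subgroup fails at a pair \<open>\<alpha>, \<beta>\<close> exactly when
  \<open>\<beta>\<close> is homotopically close to \<open>\<alpha>\<close> without being homotopic to it.

  Part (1): closeness is preserved when the same path is appended to both sides
  (lemma \<open>homotopically_close_join\<close>). So if \<open>\<beta>\<close> is close to \<open>\<alpha>\<close>, then the loop \<open>\<beta> * \<alpha>\<^sup>-\<^sup>1\<close> is
  close to the null-homotopic loop \<open>\<alpha> * \<alpha>\<^sup>-\<^sup>1\<close>. Triviality of the quasi-small group makes
  \<open>\<beta> * \<alpha>\<^sup>-\<^sup>1\<close> null-homotopic, that is, \<open>\<beta> \<simeq> \<alpha>\<close>.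

  Part (2): if \<open>f\<close> is close to \<open>h\<close>, every open neighbourhood of \<open>h\<close> given by a partition contains
  a path \<open>\<gamma> \<simeq> f\<close>, for which \<open>[\<gamma> * f\<^sup>-\<^sup>1] = 1\<close> lies in \<open>H\<close>. The Hausdorff property relative to \<open>H\<close>
  then leaves only \<open>[h * f\<^sup>-\<^sup>1] \<in> H\<close> (lemma \<open>Hausdorff_rel_close_imp_quotient_in\<close>). With
  \<open>[h] \<in> H\<close> this gives \<open>[f] \<in> H\<close>. In the absolute case it even gives \<open>[f] = [h]\<close>, which settles
  all subgroups at once.
\<close>

lemma homotopic_paths_imp_path_class_eq:
  assumes "homotopic_paths X f g"
  shows "path_class X f = path_class X g"
  unfolding path_class_def
  using assms by (blast intro: homotopic_paths_trans homotopic_paths_sym)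

lemma one_fundamental_group: "\<one>\<^bsub>fundamental_group X x\<^esub> = path_class X (\<lambda>_. x)"
  by (simp add: fundamental_group_def)

lemma path_in_join:
  "path_in X f \<Longrightarrow> path_in X g \<Longrightarrow> pathfinish f = pathstart g \<Longrightarrow> path_in X (f +++ g)"
  by (simp add: path_in_def path_join_imp subset_path_image_join)

lemma path_in_reversepath: "path_in X f \<Longrightarrow> path_in X (reversepath f)"
  by (simp add: path_in_def)

text \<open>
  The right unit law, like the left one, is the image under the path of the corresponding law for
  the straight path in the interval.
\<close>

lemma homotopic_paths_rid_const:
  assumes "path_in X f"
  shows "homotopic_paths X (f +++ (\<lambda>_. pathfinish f)) f"
proof (rule homotopic_paths_image_unit_interval[OF assms])
  show "homotopic_paths {0..1} (linepath 0 (1::real) +++ linepath 1 1) (linepath 0 1)"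
    by (rule homotopic_paths_rid') (simp_all add: closed_segment_eq_real_ivl)
qed (auto simp: joinpaths_def linepath_def pathfinish_def)

lemma homotopic_paths_rinv_const:
  assumes "path_in X f"
  shows "homotopic_paths X (f +++ reversepath f) (\<lambda>_. pathstart f)"
  using homotopic_paths_linv_const[OF path_in_reversepath[OF assms]] by simp

text \<open>
  The paths need not be loops, so this is not a statement about the fundamental group; it is the
  cancellation law of the fundamental groupoid.
\<close>

lemma path_class_join_reversepath_eq_one_iff:
  assumes f: "path_in X f" and g: "path_in X g"
    and s: "pathstart f = x" "pathstart g = x" and e: "pathfinish f = pathfinish g"
  shows "path_class X (f +++ reversepath g) = \<one>\<^bsub>fundamental_group X x\<^esub> \<longleftrightarrow>
         homotopic_paths X f g"
proof
  note r = path_in_reversepath[OF g]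
  assume "path_class X (f +++ reversepath g) = \<one>\<^bsub>fundamental_group X x\<^esub>"
  then have null: "homotopic_paths X (f +++ reversepath g) (\<lambda>_. x)"
    using path_in_join[OF f r] e by (simp add: one_fundamental_group path_class_eq_iff)
  have "homotopic_paths X f (f +++ (\<lambda>_. pathfinish g))"
    using homotopic_paths_rid_const[OF f] e by (simp add: homotopic_paths_sym_eq)
  also have "homotopic_paths X \<dots> (f +++ (reversepath g +++ g))"
    using f g e homotopic_paths_linv_const[OF g]
    by (intro homotopic_paths_join) (auto simp: path_in_def pathstart_def homotopic_paths_sym_eq)
  also have "homotopic_paths X \<dots> ((f +++ reversepath g) +++ g)"
    using f g e by (intro homotopic_paths_assoc) (auto simp: path_in_def)
  also have "homotopic_paths X \<dots> ((\<lambda>_. x) +++ g)"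
    using null g by (intro homotopic_paths_join) (auto simp: path_in_def)
  also have "homotopic_paths X \<dots> g"
    using homotopic_paths_lid_const[OF g] s by simp
  finally show "homotopic_paths X f g" .
next
  assume "homotopic_paths X f g"
  then have "homotopic_paths X (f +++ reversepath g) (g +++ reversepath g)"
    using g e by (intro homotopic_paths_join) (auto simp: path_in_def)
  also have "homotopic_paths X \<dots> (\<lambda>_. x)"
    using homotopic_paths_rinv_const[OF g] s by simp
  finally show "path_class X (f +++ reversepath g) = \<one>\<^bsub>fundamental_group X x\<^esub>"
    unfolding one_fundamental_group by (rule homotopic_paths_imp_path_class_eq)
qed

lemma path_class_quotient:
  assumes "x \<in> X" and f: "f \<in> loops_at X x" and g: "g \<in> loops_at X x"
  shows "path_class X (f +++ reversepath g) =
         path_class X f \<otimes>\<^bsub>fundamental_group X x\<^esub> inv\<^bsub>fundamental_group X x\<^esub> path_class X g"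
proof -
  let ?G = "fundamental_group X x"
  interpret group ?G
    by (rule group_fundamental_group) fact
  have carr: "path_class X p \<in> carrier ?G" if "p \<in> loops_at X x" for p
    using that by (simp add: fundamental_group_def)
  note r = reversepath_in_loops_at[OF g]
  have "path_class X (reversepath g) \<otimes>\<^bsub>?G\<^esub> path_class X g = path_class X (reversepath g +++ g)"
    by (rule fundamental_group_mult_class[OF r g])
  also have "\<dots> = \<one>\<^bsub>?G\<^esub>"
    unfolding one_fundamental_group
    using homotopic_paths_linv_const[of X g] g
    by (intro homotopic_paths_imp_path_class_eq) (simp add: loops_at_def)
  finally have "inv\<^bsub>?G\<^esub> path_class X g = path_class X (reversepath g)"
    by (intro inv_equality carr g r)
  then show ?thesis
    by (simp add: fundamental_group_mult_class[OF f r])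
qed

lemma unit_partition_mono:
  assumes "unit_partition n t" "i \<le> j" "j \<le> n"
  shows "t i \<le> t j"
  using assms(2,3)
proof (induction j rule: dec_induct)
  case (step j)
  then have "t j < t (Suc j)"
    using assms(1) by (simp add: unit_partition_def)
  then show ?case
    using step by simp
qed simp

lemma homotopically_close_refl:
  assumes "path_in X f"
  shows "homotopically_close X f f"
  unfolding homotopically_close_def
proof (intro conjI allI impI)
  fix n t U
  assume "covers_path X n t U f"
  then show "\<exists>\<gamma>. follows_path X n t U f \<gamma> \<and> homotopic_paths X \<gamma> f"
    using assms by (intro exI[of _ f]) (auto simp: follows_path_def covers_path_def path_in_def)
qed (use assms in auto)

text \<open>
  A partition that covers \<open>g * k\<close> is cut at the first index \<open>m\<close> with \<open>t m \<ge> 1/2\<close>. The part before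
  it, rescaled and ended at time \<open>1\<close>, covers \<open>g\<close> with the same open sets. An approximation \<open>\<delta>\<close> of
  \<open>g\<close> there yields the approximation \<open>\<delta> * k\<close> of \<open>g * k\<close>: even when \<open>1/2\<close> is not a partition point,
  \<open>\<delta>\<close> and \<open>k\<close> both remain in \<open>U m\<close> on their halves of the interval around \<open>1/2\<close>.
\<close>

lemma homotopically_close_join:
  assumes close: "homotopically_close X f g"
    and k: "path_in X k" and gk: "pathfinish g = pathstart k"
  shows "homotopically_close X (f +++ k) (g +++ k)"
  unfolding homotopically_close_def
proof (intro conjI allI impI)
  have f: "path_in X f" and g: "path_in X g" and ends: "pathstart f = pathstart g"
    "pathfinish f = pathfinish g"
    using close by (auto simp: homotopically_close_def)
  show "path_in X (f +++ k)" "path_in X (g +++ k)"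
    using f g k gk ends by (auto intro: path_in_join)
  show "pathstart (f +++ k) = pathstart (g +++ k)" "pathfinish (f +++ k) = pathfinish (g +++ k)"
    using ends by auto
  fix n t U
  assume part: "unit_partition n t" and cov: "covers_path X n t U (g +++ k)"
  define m where "m = (LEAST i. 1/2 \<le> t i)"
  have tn: "t 0 = 0" "t n = 1"
    using part by (auto simp: unit_partition_def)
  then have tm: "1/2 \<le> t m" and mn: "m \<le> n"
    unfolding m_def by (auto intro: LeastI[of _ n] Least_le)
  have before: "t i < 1/2" if "i < m" for i
    using not_less_Least[of i "\<lambda>i. 1/2 \<le> t i"] that by (auto simp: m_def)
  have m0: "0 < m"
    using tm tn by (cases m) auto
  have after: "1/2 \<le> t i" if "m \<le> i" "i \<le> n" for i
    using unit_partition_mono[OF part that] tm by simp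
  define s where "s i = (if i < m then 2 * t i else 1)" for i
  have "unit_partition m s"
    unfolding unit_partition_def
  proof (intro conjI allI impI)
    fix i assume "i < m"
    then show "s i < s (Suc i)"
      using part before[of i] mn by (simp add: unit_partition_def s_def)
  qed (use m0 tn in \<open>simp_all add: s_def\<close>)
  moreover have "covers_path X m s U g"
    unfolding covers_path_def
  proof (intro ballI conjI)
    fix i assume i: "i \<in> {1..m}"
    then have iU: "openin (top_of_set X) (U i)" "(g +++ k) ` {t (i - 1)..t i} \<subseteq> U i"
      using cov mn by (auto simp: covers_path_def)
    show "openin (top_of_set X) (U i)" by fact
    have lo: "s (i - 1) = 2 * t (i - 1)"
      using i by (auto simp: s_def)
    have hi: "s i \<le> 2 * t i" "s i \<le> 1"
      using i before[of i] tm by (cases "i = m"; force simp: s_def)+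
    show "g ` {s (i - 1)..s i} \<subseteq> U i"
    proof
      fix y assume "y \<in> g ` {s (i - 1)..s i}"
      then obtain u where u: "y = g u" "s (i - 1) \<le> u" "u \<le> s i" by auto
      then have "u / 2 \<in> {t (i - 1)..t i}" "y = (g +++ k) (u / 2)"
        using lo hi by (auto simp: joinpaths_def)
      then show "y \<in> U i" using iU by blast
    qed
  qed
  ultimately obtain \<delta> where fol: "follows_path X m s U g \<delta>" and hom: "homotopic_paths X \<delta> f"
    using close unfolding homotopically_close_def by blast
  have \<delta>: "path_in X \<delta>" "pathfinish \<delta> = pathstart k"
    using fol homotopic_paths_imp_pathfinish[OF hom] ends gk by (auto simp: follows_path_def)
  have hom': "homotopic_paths X (\<delta> +++ k) (f +++ k)"
    using hom k \<delta> by (intro homotopic_paths_join) (auto simp: path_in_def)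
  have agree: "(\<delta> +++ k) u = (g +++ k) u" if "1/2 \<le> u" for u
  proof (cases "u = 1/2")
    case True
    show ?thesis
      unfolding True using \<delta>(2) gk by (simp add: joinpaths_def pathfinish_def)
  qed (use that in \<open>simp add: joinpaths_def\<close>)
  have "follows_path X n t U (g +++ k) (\<delta> +++ k)"
    unfolding follows_path_def
  proof (intro conjI ballI)
    show "path_in X (\<delta> +++ k)"
      using \<delta> k by (intro path_in_join)
  next
    fix i assume i: "i \<in> {1..n}"
    then have iU: "(g +++ k) ` {t (i - 1)..t i} \<subseteq> U i"
      using cov by (auto simp: covers_path_def)
    show "(\<delta> +++ k) ` {t (i - 1)..t i} \<subseteq> U i"
    proof
      fix y assume "y \<in> (\<delta> +++ k) ` {t (i - 1)..t i}"
      then obtain u where u: "y = (\<delta> +++ k) u" "u \<in> {t (i - 1)..t i}" by auto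
      show "y \<in> U i"
      proof (cases "u \<le> 1/2")
        case False
        then have "y = (g +++ k) u"
          using u by (simp add: agree)
        then show ?thesis using iU u by blast
      next
        case True
        show ?thesis
        proof (cases "i \<le> m")
          case im: True
          then have "\<delta> ` {s (i - 1)..s i} \<subseteq> U i"
            using fol i by (auto simp: follows_path_def)
          moreover have "2 * u \<in> {s (i - 1)..s i}"
            using u im i True by (auto simp: s_def)
          ultimately show ?thesis
            using u True by (auto simp: joinpaths_def)
        next
          case False
          then have "1/2 \<le> t (i - 1)"
            using i by (intro after) auto
          then have "y = (g +++ k) u"
            using u by (simp add: agree)
          then show ?thesis using iU u by blast
        qed
      qed
    qed
  next
    fix i assume i: "i \<in> {0..n}"
    show "(\<delta> +++ k) (t i) = (g +++ k) (t i)"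
    proof (cases "i < m")
      case True
      then have "\<delta> (s i) = g (s i)"
        using fol by (auto simp: follows_path_def)
      then show ?thesis
        using before[OF True] True by (simp add: joinpaths_def s_def)
    next
      case False
      then have "1/2 \<le> t i"
        using i by (intro after) auto
      then show ?thesis
        by (rule agree)
    qed
  qed
  then show "\<exists>\<gamma>. follows_path X n t U (g +++ k) \<gamma> \<and> homotopic_paths X \<gamma> (f +++ k)"
    using hom' by blast
qed

text \<open>
  Closeness and the Hausdorff property are opposed with the roles \<open>\<alpha> = h\<close>, \<open>\<beta> = f\<close>: the path
  being approximated is \<open>h\<close>, and approximations homotopic to \<open>f\<close> have trivial quotient by \<open>f\<close>.
\<close>

lemma Hausdorff_rel_close_imp_quotient_in:
  assumes Haus: "homotopically_path_Hausdorff_rel X x H"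
    and one: "\<one>\<^bsub>fundamental_group X x\<^esub> \<in> H"
    and close: "homotopically_close X f h" and start: "pathstart h = x"
  shows "path_class X (h +++ reversepath f) \<in> H"
proof (rule ccontr)
  have f: "path_in X f" "pathstart f = x" "pathfinish h = pathfinish f" and h: "path_in X h"
    using close start by (auto simp: homotopically_close_def)
  assume "path_class X (h +++ reversepath f) \<notin> H"
  then obtain n t U where U: "unit_partition n t" "covers_path X n t U h"
    and avoid: "\<And>\<gamma>. follows_path X n t U h \<gamma> \<Longrightarrow> path_class X (\<gamma> +++ reversepath f) \<notin> H"
    using Haus f h start unfolding homotopically_path_Hausdorff_rel_def paths_from_def by blast
  obtain \<gamma> where \<gamma>: "follows_path X n t U h \<gamma>" "homotopic_paths X \<gamma> f"
    using close U unfolding homotopically_close_def by blast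
  then have "path_class X (\<gamma> +++ reversepath f) = \<one>\<^bsub>fundamental_group X x\<^esub>"
    using f homotopic_paths_imp_pathstart[OF \<gamma>(2)] homotopic_paths_imp_pathfinish[OF \<gamma>(2)]
    by (subst path_class_join_reversepath_eq_one_iff) (auto simp: follows_path_def)
  then show False
    using avoid[OF \<gamma>(1)] one by simp
qed

lemma subgroup_subset_pi1_qs:
  assumes "subgroup H (fundamental_group X x)"
  shows "H \<subseteq> pi1_qs X x H"
proof
  fix A assume A: "A \<in> H"
  then obtain f where f: "f \<in> loops_at X x" "A = path_class X f"
    using subgroup.mem_carrier[OF assms A] by (auto simp: fundamental_group_def)
  moreover have "homotopically_close X f f"
    using f by (intro homotopically_close_refl) (simp add: loops_at_def)
  ultimately show "A \<in> pi1_qs X x H"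
    using A unfolding pi1_qs_def by blast
qed

lemma pi1_qs_eq_if_Hausdorff_rel:
  assumes x: "x \<in> X" and H: "subgroup H (fundamental_group X x)"
    and Haus: "homotopically_path_Hausdorff_rel X x H"
  shows "pi1_qs X x H = H"
proof
  let ?G = "fundamental_group X x"
  interpret group ?G
    by (rule group_fundamental_group) fact
  show "pi1_qs X x H \<subseteq> H"
  proof
    fix A assume "A \<in> pi1_qs X x H"
    then obtain f h where f: "f \<in> loops_at X x" "A = path_class X f"
      and h: "h \<in> loops_at X x" "path_class X h \<in> H" and close: "homotopically_close X f h"
      unfolding pi1_qs_def by blast
    have "path_class X (h +++ reversepath f) \<in> H"
      using h by (intro Hausdorff_rel_close_imp_quotient_in[OF Haus _ close]
          subgroup.one_closed[OF H]) (simp add: loops_at_def)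
    then have q: "path_class X h \<otimes>\<^bsub>?G\<^esub> inv\<^bsub>?G\<^esub> A \<in> H"
      using path_class_quotient[OF x h(1) f(1)] f by simp
    have carr: "A \<in> carrier ?G" "path_class X h \<in> carrier ?G"
      using f h by (auto simp: fundamental_group_def)
    have "inv\<^bsub>?G\<^esub> (path_class X h \<otimes>\<^bsub>?G\<^esub> inv\<^bsub>?G\<^esub> A) \<otimes>\<^bsub>?G\<^esub> path_class X h \<in> H"
      by (rule subgroup.m_closed[OF H subgroup.m_inv_closed[OF H q] h(2)])
    moreover have "inv\<^bsub>?G\<^esub> (path_class X h \<otimes>\<^bsub>?G\<^esub> inv\<^bsub>?G\<^esub> A) \<otimes>\<^bsub>?G\<^esub> path_class X h = A"
      using carr by (simp add: inv_mult_group m_assoc)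
    ultimately show "A \<in> H"
      by simp
  qed
  show "H \<subseteq> pi1_qs X x H"
    by (rule subgroup_subset_pi1_qs) fact
qed

text \<open>
  The absolute property forces a loop that is close to \<open>h\<close> to be homotopic to \<open>h\<close>, so passing to
  close loops adds no classes to any subgroup.
\<close>

lemma pi1_qs_eq_if_Hausdorff:
  assumes H: "subgroup H (fundamental_group X x)" and Haus: "homotopically_path_Hausdorff X x"
  shows "pi1_qs X x H = H"
proof
  show "pi1_qs X x H \<subseteq> H"
  proof
    fix A assume "A \<in> pi1_qs X x H"
    then obtain f h where f: "f \<in> loops_at X x" "A = path_class X f"
      and h: "h \<in> loops_at X x" "path_class X h \<in> H" and close: "homotopically_close X f h"
      unfolding pi1_qs_def by blast
    have "path_class X (h +++ reversepath f) \<in> {\<one>\<^bsub>fundamental_group X x\<^esub>}"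
      using h Haus by (intro Hausdorff_rel_close_imp_quotient_in[OF _ _ close])
        (auto simp: loops_at_def homotopically_path_Hausdorff_def)
    then have "homotopic_paths X h f"
      using path_class_join_reversepath_eq_one_iff[of X h f x] f h by (simp add: loops_at_def)
    then show "A \<in> H"
      using h f homotopic_paths_imp_path_class_eq by metis
  qed
  show "H \<subseteq> pi1_qs X x H"
    by (rule subgroup_subset_pi1_qs) fact
qed

lemma Hausdorff_if_pi1_qs_trivial:
  assumes triv: "pi1_qs X x {\<one>\<^bsub>fundamental_group X x\<^esub>} = {\<one>\<^bsub>fundamental_group X x\<^esub>}"
  shows "homotopically_path_Hausdorff X x"
  unfolding homotopically_path_Hausdorff_def homotopically_path_Hausdorff_rel_def
proof (intro ballI impI, rule ccontr)
  let ?one = "\<one>\<^bsub>fundamental_group X x\<^esub>"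
  fix \<alpha> \<beta>
  assume "\<alpha> \<in> paths_from X x" "\<beta> \<in> paths_from X x" and e: "pathfinish \<alpha> = pathfinish \<beta>"
    and ne: "path_class X (\<alpha> +++ reversepath \<beta>) \<notin> {?one}"
    and no: "\<not> (\<exists>n t U. unit_partition n t \<and> covers_path X n t U \<alpha> \<and>
      (\<forall>\<gamma>. follows_path X n t U \<alpha> \<gamma> \<longrightarrow> path_class X (\<gamma> +++ reversepath \<beta>) \<notin> {?one}))"
  then have \<alpha>: "path_in X \<alpha>" "pathstart \<alpha> = x" and \<beta>: "path_in X \<beta>" "pathstart \<beta> = x"
    by (auto simp: paths_from_def)
  have "homotopically_close X \<beta> \<alpha>"
    unfolding homotopically_close_def
  proof (intro conjI allI impI)
    fix n t U
    assume U: "unit_partition n t" "covers_path X n t U \<alpha>"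
    then obtain \<gamma> where \<gamma>: "follows_path X n t U \<alpha> \<gamma>"
      and one: "path_class X (\<gamma> +++ reversepath \<beta>) = ?one"
      using no by blast
    have "path_in X \<gamma>" "\<gamma> (t 0) = \<alpha> (t 0)" "\<gamma> (t n) = \<alpha> (t n)"
      using \<gamma> by (auto simp: follows_path_def)
    moreover have "t 0 = 0" "t n = 1"
      using U by (auto simp: unit_partition_def)
    ultimately have "homotopic_paths X \<gamma> \<beta>"
      using path_class_join_reversepath_eq_one_iff[of X \<gamma> \<beta> x] one \<alpha> \<beta> e
      by (simp add: pathstart_def pathfinish_def)
    then show "\<exists>\<gamma>. follows_path X n t U \<alpha> \<gamma> \<and> homotopic_paths X \<gamma> \<beta>"
      using \<gamma> by blast
  qed (use \<alpha> \<beta> e in auto)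
  then have "homotopically_close X (\<beta> +++ reversepath \<alpha>) (\<alpha> +++ reversepath \<alpha>)"
    using \<alpha> by (intro homotopically_close_join path_in_reversepath) auto
  moreover have "path_class X (\<alpha> +++ reversepath \<alpha>) = ?one"
    using \<alpha> by (subst path_class_join_reversepath_eq_one_iff) (auto simp: path_in_def)
  moreover have "\<alpha> +++ reversepath \<alpha> \<in> loops_at X x" "\<beta> +++ reversepath \<alpha> \<in> loops_at X x"
    using \<alpha> \<beta> e by (auto simp: loops_at_def intro!: path_in_join path_in_reversepath)
  ultimately have "path_class X (\<beta> +++ reversepath \<alpha>) \<in> pi1_qs X x {?one}"
    unfolding pi1_qs_def by blast
  then have "path_class X (\<beta> +++ reversepath \<alpha>) = ?one"
    using triv by simp
  then have "homotopic_paths X \<alpha> \<beta>"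
    using \<alpha> \<beta> e by (subst homotopic_paths_sym_eq)
      (simp add: path_class_join_reversepath_eq_one_iff)
  then show False
    using ne \<alpha> \<beta> e by (simp add: path_class_join_reversepath_eq_one_iff)
qed

theorem theorem3p12:
  fixes X :: "'a::topological_space set" and x :: 'a
  assumes "path_connected X" and "x \<in> X"
  shows "(pi1_qs X x {\<one>\<^bsub>fundamental_group X x\<^esub>} = {\<one>\<^bsub>fundamental_group X x\<^esub>} \<longrightarrow>
            homotopically_path_Hausdorff X x)
       \<and> (\<forall>H. subgroup H (fundamental_group X x) \<longrightarrow>
            homotopically_path_Hausdorff_rel X x H \<longrightarrow> pi1_qs X x H = H)
       \<and> (homotopically_path_Hausdorff X x \<longrightarrow>
            (\<forall>H. subgroup H (fundamental_group X x) \<longrightarrow> pi1_qs X x H = H))"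
  by (simp_all add: Hausdorff_if_pi1_qs_trivial pi1_qs_eq_if_Hausdorff
    pi1_qs_eq_if_Hausdorff_rel[OF assms(2)])

end
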